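(* Let $Q$ be a set of prime integers. Then $J_Q$ is a prime ideal of $\mathcal{A}$.
   Context: $\mathds{N}$ denotes the non-negative integers and $\mathds{N}^+=\mathds{N}\setminus\{0\}$. $\mathcal{A}$ is the ring of arithmetical functions: the set of all functions $f\colon \mathds{N}^+\to\mathds{C}$ with pointwise addition $(f+g)(n)=f(n)+g(n)$ and Dirichlet convolution $(f*g)(n)=\sum_{ij=n}f(i)g(j)$ as multiplication. It is a commutative ring with identity $e$, where $e(1)=1$ and $e(n)=0$ for $n>1$. For a set $Q$ of (positive) prime integers, $\Pi_Q := \{q_1^{a_1}q_2^{a_2}\cdots q_t^{a_t} \mid t\in\mathds{N},\ q_1,\dots,q_t\in Q,\ a_1,\dots,a_t\in\mathds{N}\}$ is the set of finite products of elements of $Q$ (the empty product $1$ is included), and $J_Q := \{f\in\mathcal{A} \mid f(n)=0 \text{ if } n\in\Pi_Q\}$. *)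

theory Defs
  imports Complex_Main "HOL-Algebra.Ideal" "HOL-Library.FuncSet"
    "HOL-Computational_Algebra.Primes"
begin

text \<open>
  Functions on the positive integers are represented as extensional functions on
  \<open>{1..} :: nat set\<close>, so that the value at the junk argument 0 is fixed and equality of
  functions is equality on the positive integers.
\<close>

definition dirichlet_conv :: "(nat \<Rightarrow> complex) \<Rightarrow> (nat \<Rightarrow> complex) \<Rightarrow> nat \<Rightarrow> complex" where
  "dirichlet_conv f g = (\<lambda>n\<in>{1..}. \<Sum>(i, j)\<in>{(i, j). i * j = n}. f i * g j)"

definition arith_ring :: "(nat \<Rightarrow> complex) ring" where
  "arith_ring =
    \<lparr>carrier = {1..} \<rightarrow>\<^sub>E (UNIV :: complex set),
     monoid.mult = dirichlet_conv,
     one = (\<lambda>n\<in>{1..}. if n = 1 then 1 else 0),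
     zero = (\<lambda>n\<in>{1..}. 0),
     add = (\<lambda>f g. \<lambda>n\<in>{1..}. f n + g n)\<rparr>"

text \<open>The \<open>q i\<close> need not be distinct, and \<open>t = 0\<close> gives the empty product 1.\<close>

definition prods_of :: "nat set \<Rightarrow> nat set" where
  "prods_of Q = {\<Prod>i<t. q i ^ a i | (t :: nat) (q :: nat \<Rightarrow> nat) (a :: nat \<Rightarrow> nat). \<forall>i<t. q i \<in> Q}"

definition J_ideal :: "nat set \<Rightarrow> (nat \<Rightarrow> complex) set" where
  "J_ideal Q = {f \<in> carrier arith_ring. \<forall>n\<in>prods_of Q. f n = 0}"

end

theory Submission
  imports Defs
begin

text \<open>
  If all elements of \<open>Q\<close> are prime, \<open>prods_of Q\<close> is the set of positive integers whose prime
  divisors all lie in \<open>Q\<close> (\<open>prods_of_primes\<close>). A product of positive integers therefore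
  belongs to \<open>prods_of Q\<close> exactly when both factors do. The value of \<open>f * g\<close> at a point of
  \<open>prods_of Q\<close> thus involves only values of \<open>f\<close> and \<open>g\<close> on \<open>prods_of Q\<close>, which makes
  \<open>J_ideal Q\<close> an ideal.

  For primality, suppose that neither \<open>f\<close> nor \<open>g\<close> vanishes on \<open>prods_of Q\<close>, and let \<open>m\<close> and
  \<open>k\<close> be the least elements of \<open>prods_of Q\<close> at which \<open>f\<close> and \<open>g\<close>, respectively, are nonzero.
  In a factorization \<open>m * k = i * j\<close> other than \<open>i = m\<close>, \<open>j = k\<close>, either \<open>i < m\<close> or \<open>j < k\<close>,
  so that \<open>f i * g j = 0\<close>. Hence \<open>(f * g) (m * k) = f m * g k \<noteq> 0\<close>, and \<open>f * g\<close> does not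
  vanish on \<open>prods_of Q\<close>. Because the usual order of the positive integers is a well-order
  compatible with multiplication, this works for infinite \<open>Q\<close> as well.
\<close>

section \<open>The ring of arithmetical functions\<close>

lemma finite_factor_pairs:
  fixes n :: nat
  assumes "n \<ge> 1"
  shows "finite {(i, j). i * j = n}"
proof (rule finite_subset)
  show "{(i, j). i * j = n} \<subseteq> {..n} \<times> {..n}"
    using assms by (auto intro: Suc_leI)
qed simp

lemma dirichlet_conv_apply:
  "n \<ge> 1 \<Longrightarrow> dirichlet_conv f g n = (\<Sum>(i, j)\<in>{(i, j). i * j = n}. f i * g j)"
  by (simp add: dirichlet_conv_def)

lemma dirichlet_conv_in_carrier: "dirichlet_conv f g \<in> carrier arith_ring"
  by (auto simp: dirichlet_conv_def arith_ring_def)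

lemma dirichlet_conv_commute: "dirichlet_conv f g = dirichlet_conv g f"
proof -
  have "(\<Sum>(i, j)\<in>{(i, j). i * j = n}. f i * g j) =
        (\<Sum>(i, j)\<in>{(i, j). i * j = n}. g i * f j)" for n
    by (rule sum.reindex_bij_witness[where i = prod.swap and j = prod.swap])
       (auto simp: mult.commute)
  then show ?thesis
    by (simp add: dirichlet_conv_def)
qed

text \<open>
  Both bracketings expand to the sum of \<open>f a * g b * h c\<close> over all factorizations
  \<open>n = a * b * c\<close>.
\<close>

lemma dirichlet_conv_assoc:
  "dirichlet_conv (dirichlet_conv f g) h = dirichlet_conv f (dirichlet_conv g h)"
proof
  fix n :: nat
  show "dirichlet_conv (dirichlet_conv f g) h n = dirichlet_conv f (dirichlet_conv g h) n"
  proof (cases "n \<ge> 1")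
    case True
    define P where "P = (\<lambda>m::nat. {(i, j). i * j = m})"
    have fin: "finite (P m)" if "m \<ge> 1" for m
      using finite_factor_pairs[OF that] by (simp add: P_def)
    have conv: "dirichlet_conv u v m = (\<Sum>x\<in>P m. u (fst x) * v (snd x))" if "m \<ge> 1" for u v m
      using dirichlet_conv_apply[OF that, of u v] by (simp add: P_def case_prod_beta)
    have pos: "fst x \<ge> 1" "snd x \<ge> 1" if "x \<in> P n" for x
      using that True by (auto simp: P_def Suc_le_eq intro!: Nat.gr0I)
    have "dirichlet_conv (dirichlet_conv f g) h n =
        (\<Sum>x\<in>P n. \<Sum>y\<in>P (fst x). f (fst y) * g (snd y) * h (snd x))"
      by (auto simp: conv[OF True] conv[OF pos(1)] sum_distrib_right intro!: sum.cong)
    also have "\<dots> = (\<Sum>(x, y)\<in>(SIGMA x:P n. P (fst x)). f (fst y) * g (snd y) * h (snd x))"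
      by (rule sum.Sigma) (use True pos fin in auto)
    also have "\<dots> = (\<Sum>(x, y)\<in>(SIGMA x:P n. P (snd x)). f (fst x) * (g (fst y) * h (snd y)))"
      by (rule sum.reindex_bij_witness
          [where i = "\<lambda>((a, _), (b, c)). ((a * b, c), (a, b))"
             and j = "\<lambda>((_, c), (a, b)). ((a, b * c), (b, c))"])
         (auto simp: P_def mult.assoc)
    also have "\<dots> = (\<Sum>x\<in>P n. \<Sum>y\<in>P (snd x). f (fst x) * (g (fst y) * h (snd y)))"
      by (rule sum.Sigma[symmetric]) (use True pos fin in auto)
    also have "\<dots> = dirichlet_conv f (dirichlet_conv g h) n"
      by (auto simp: conv[OF True] conv[OF pos(2)] sum_distrib_left intro!: sum.cong)
    finally show ?thesis .
  qed (simp add: dirichlet_conv_def)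
qed

lemma one_dirichlet_conv:
  assumes "f \<in> carrier arith_ring"
  shows "dirichlet_conv \<one>\<^bsub>arith_ring\<^esub> f = f"
proof
  fix n :: nat
  show "dirichlet_conv \<one>\<^bsub>arith_ring\<^esub> f n = f n"
  proof (cases "n \<ge> 1")
    case True
    have "dirichlet_conv \<one>\<^bsub>arith_ring\<^esub> f n = (\<Sum>(i, j)\<in>{(1, n)}. \<one>\<^bsub>arith_ring\<^esub> i * f j)"
      unfolding dirichlet_conv_apply[OF True]
      by (rule sum.mono_neutral_right)
         (use True finite_factor_pairs[OF True] in
           \<open>auto simp: arith_ring_def Suc_le_eq split: if_splits\<close>)
    then show ?thesis
      by (simp add: arith_ring_def)
  next
    case False
    then have "f n = undefined"
      using assms by (auto simp: arith_ring_def PiE_def extensional_def)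
    with False show ?thesis
      by (simp add: dirichlet_conv_def)
  qed
qed

lemma dirichlet_conv_add_distrib:
  "dirichlet_conv (f \<oplus>\<^bsub>arith_ring\<^esub> g) h =
    dirichlet_conv f h \<oplus>\<^bsub>arith_ring\<^esub> dirichlet_conv g h"
proof
  fix n :: nat
  show "dirichlet_conv (f \<oplus>\<^bsub>arith_ring\<^esub> g) h n =
    (dirichlet_conv f h \<oplus>\<^bsub>arith_ring\<^esub> dirichlet_conv g h) n"
  proof (cases "n \<ge> 1")
    case True
    have "(f \<oplus>\<^bsub>arith_ring\<^esub> g) i * h j = f i * h j + g i * h j" if "i * j = n" for i j
    proof -
      have "i \<ge> 1"
        using that True by (cases i) auto
      then show ?thesis
        by (simp add: arith_ring_def algebra_simps)
    qed
    then have "dirichlet_conv (f \<oplus>\<^bsub>arith_ring\<^esub> g) h n =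
        (\<Sum>(i, j)\<in>{(i, j). i * j = n}. f i * h j + g i * h j)"
      unfolding dirichlet_conv_apply[OF True] by (intro sum.cong) auto
    also have "\<dots> = dirichlet_conv f h n + dirichlet_conv g h n"
      by (simp add: dirichlet_conv_apply[OF True] case_prod_beta sum.distrib)
    finally show ?thesis
      using True by (simp add: arith_ring_def)
  qed (simp add: dirichlet_conv_def arith_ring_def)
qed

lemma abelian_group_arith_ring: "abelian_group arith_ring"
proof (rule abelian_groupI)
  fix f assume "f \<in> carrier arith_ring"
  then show "\<exists>g\<in>carrier arith_ring. g \<oplus>\<^bsub>arith_ring\<^esub> f = \<zero>\<^bsub>arith_ring\<^esub>"
    by (intro bexI[of _ "\<lambda>n\<in>{1..}. - f n"]) (auto simp: arith_ring_def fun_eq_iff)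
next
  fix f assume "f \<in> carrier arith_ring"
  then show "\<zero>\<^bsub>arith_ring\<^esub> \<oplus>\<^bsub>arith_ring\<^esub> f = f"
    by (auto simp: arith_ring_def fun_eq_iff PiE_def extensional_def restrict_def)
qed (auto simp: arith_ring_def fun_eq_iff algebra_simps)

lemma cring_arith_ring: "cring arith_ring"
proof (rule cringI)
  have mult: "monoid.mult arith_ring = dirichlet_conv"
    by (simp add: arith_ring_def)
  show "comm_monoid arith_ring"
    by (rule comm_monoidI, unfold mult)
       (use dirichlet_conv_in_carrier dirichlet_conv_assoc one_dirichlet_conv
          dirichlet_conv_commute in \<open>auto simp: arith_ring_def\<close>)
  show "(f \<oplus>\<^bsub>arith_ring\<^esub> g) \<otimes>\<^bsub>arith_ring\<^esub> h =
      f \<otimes>\<^bsub>arith_ring\<^esub> h \<oplus>\<^bsub>arith_ring\<^esub> g \<otimes>\<^bsub>arith_ring\<^esub> h" for f g h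
    by (simp add: mult dirichlet_conv_add_distrib)
qed (rule abelian_group_arith_ring)

section \<open>Products of elements of a set of primes\<close>

lemma one_in_prods_of: "1 \<in> prods_of Q"
  unfolding prods_of_def by (auto intro!: exI[of _ "0::nat"])

lemma mult_in_prods_of:
  assumes "m \<in> prods_of Q" "p \<in> Q"
  shows "m * p \<in> prods_of Q"
proof -
  obtain t :: nat and q a where m: "m = (\<Prod>i<t. q i ^ a i)" and q: "\<forall>i<t. q i \<in> Q"
    using assms(1) unfolding prods_of_def by blast
  have "m * p = (\<Prod>i<Suc t. (q(t := p)) i ^ (a(t := 1)) i)"
    by (simp add: m)
  moreover have "\<forall>i<Suc t. (q(t := p)) i \<in> Q"
    using q assms(2) by (auto simp: less_Suc_eq)
  ultimately show ?thesis
    unfolding prods_of_def by blast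
qed

text \<open>
  Divisibility by primes replaces the explicit representation as an indexed product of powers,
  in which the bases may repeat and exponents may be zero.
\<close>

lemma prods_of_primes:
  assumes "\<forall>q\<in>Q. prime q"
  shows "prods_of Q = {n. n > 0 \<and> (\<forall>p. prime p \<longrightarrow> p dvd n \<longrightarrow> p \<in> Q)}"
proof (intro equalityI subsetI)
  fix n assume "n \<in> prods_of Q"
  then obtain t :: nat and q a where n: "n = (\<Prod>i<t. q i ^ a i)" and q: "\<forall>i<t. q i \<in> Q"
    unfolding prods_of_def by blast
  have "p \<in> Q" if "prime p" "p dvd n" for p
  proof -
    obtain i where "i < t" "p dvd q i ^ a i"
      using \<open>prime p\<close> \<open>p dvd n\<close> unfolding n by (auto simp: prime_dvd_prod_iff)
    then have "p = q i"
      using q assms \<open>prime p\<close> by (meson prime_dvd_power primes_dvd_imp_eq)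
    with q \<open>i < t\<close> show ?thesis by simp
  qed
  moreover have "n > 0"
    unfolding n using q assms by (intro prod_pos) (auto simp: prime_gt_0_nat)
  ultimately show "n \<in> {n. n > 0 \<and> (\<forall>p. prime p \<longrightarrow> p dvd n \<longrightarrow> p \<in> Q)}"
    by simp
next
  fix n assume "n \<in> {n. n > 0 \<and> (\<forall>p. prime p \<longrightarrow> p dvd n \<longrightarrow> p \<in> Q)}"
  then show "n \<in> prods_of Q"
  proof (induction n rule: less_induct)
    case (less n)
    show ?case
    proof (cases "n = 1")
      case False
      then obtain p where p: "prime p" "p dvd n"
        using prime_factor_nat by blast
      then obtain m where m: "n = m * p"
        by (auto elim: dvdE simp: mult.commute)
      have "m < n" "m > 0"
        using m less.prems prime_gt_1_nat[OF p(1)] by auto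
      then have "m \<in> prods_of Q"
        using less m by auto
      moreover have "p \<in> Q"
        using less.prems p by auto
      ultimately show ?thesis
        unfolding m by (rule mult_in_prods_of)
    qed (use one_in_prods_of[of Q] in simp)
  qed
qed

text \<open>
  A prime dividing \<open>m * n\<close> divides \<open>m\<close> or \<open>n\<close>. The direction from the product to its factors is
  the one that confines a convolution at a point of \<open>prods_of Q\<close> to values on \<open>prods_of Q\<close>.
\<close>

lemma mult_in_prods_of_iff:
  assumes "\<forall>q\<in>Q. prime q"
  shows "m * n \<in> prods_of Q \<longleftrightarrow> m \<in> prods_of Q \<and> n \<in> prods_of Q"
  unfolding prods_of_primes[OF assms] by (auto simp: prime_dvd_mult_iff)

section \<open>Primality of the vanishing ideal\<close>

lemma ideal_J_ideal:
  assumes "\<forall>q\<in>Q. prime q"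
  shows "ideal (J_ideal Q) arith_ring"
proof -
  interpret A: cring arith_ring by (rule cring_arith_ring)
  have ge1: "n \<ge> 1" if "n \<in> prods_of Q" for n
    using that prods_of_primes[OF assms] by auto
  have absorb: "f \<otimes>\<^bsub>arith_ring\<^esub> g \<in> J_ideal Q"
    if f: "f \<in> J_ideal Q" and g: "g \<in> carrier arith_ring" for f g
  proof -
    have "dirichlet_conv f g n = 0" if n: "n \<in> prods_of Q" for n
    proof -
      have "f i * g j = 0" if "i * j = n" for i j
        using n f that mult_in_prods_of_iff[OF assms] by (auto simp: J_ideal_def)
      then show ?thesis
        unfolding dirichlet_conv_apply[OF ge1[OF n]] by (intro sum.neutral) auto
    qed
    then show ?thesis
      using dirichlet_conv_in_carrier by (auto simp: J_ideal_def arith_ring_def)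
  qed
  show ?thesis
  proof (rule idealI)
    show "subgroup (J_ideal Q) (add_monoid arith_ring)"
    proof (rule A.add.subgroupI)
      show "J_ideal Q \<subseteq> carrier arith_ring"
        by (auto simp: J_ideal_def)
      have "\<zero>\<^bsub>arith_ring\<^esub> \<in> J_ideal Q"
        using ge1 by (auto simp: J_ideal_def arith_ring_def)
      then show "J_ideal Q \<noteq> {}"
        by blast
    next
      fix f assume f: "f \<in> J_ideal Q"
      then have "f \<in> carrier arith_ring"
        by (simp add: J_ideal_def)
      then have "\<ominus>\<^bsub>arith_ring\<^esub> f = f \<otimes>\<^bsub>arith_ring\<^esub> (\<ominus>\<^bsub>arith_ring\<^esub> \<one>\<^bsub>arith_ring\<^esub>)"
        by (simp add: A.r_minus)
      with absorb[OF f] show "\<ominus>\<^bsub>arith_ring\<^esub> f \<in> J_ideal Q"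
        by simp
    next
      fix f g assume "f \<in> J_ideal Q" "g \<in> J_ideal Q"
      then show "f \<oplus>\<^bsub>arith_ring\<^esub> g \<in> J_ideal Q"
        using ge1 by (auto simp: J_ideal_def arith_ring_def)
    qed
  next
    fix f g assume fg: "f \<in> J_ideal Q" "g \<in> carrier arith_ring"
    then show "f \<otimes>\<^bsub>arith_ring\<^esub> g \<in> J_ideal Q"
      by (rule absorb)
    then show "g \<otimes>\<^bsub>arith_ring\<^esub> f \<in> J_ideal Q"
      using fg by (simp add: A.m_comm J_ideal_def)
  qed (rule A.ring_axioms)
qed

text \<open>
  The least elements of \<open>prods_of Q\<close> in the supports of \<open>f\<close> and \<open>g\<close> contribute the only nonzero
  term of the convolution at their product.
\<close>

lemma dirichlet_conv_nonzero_on_prods_of: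
  assumes Q: "\<forall>q\<in>Q. prime q"
    and f: "\<exists>m\<in>prods_of Q. f m \<noteq> 0" and g: "\<exists>k\<in>prods_of Q. g k \<noteq> 0"
  shows "\<exists>n\<in>prods_of Q. dirichlet_conv f g n \<noteq> 0"
proof -
  obtain m where m: "m \<in> prods_of Q" "f m \<noteq> 0"
    and m_min: "\<And>i. i \<in> prods_of Q \<Longrightarrow> i < m \<Longrightarrow> f i = 0"
    using exists_least_iff[of "\<lambda>i. i \<in> prods_of Q \<and> f i \<noteq> 0", THEN iffD1] f[unfolded Bex_def]
    by metis
  obtain k where k: "k \<in> prods_of Q" "g k \<noteq> 0"
    and k_min: "\<And>j. j \<in> prods_of Q \<Longrightarrow> j < k \<Longrightarrow> g j = 0"
    using exists_least_iff[of "\<lambda>j. j \<in> prods_of Q \<and> g j \<noteq> 0", THEN iffD1] g[unfolded Bex_def]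
    by metis
  have mk: "m * k \<in> prods_of Q"
    using m k mult_in_prods_of_iff[OF Q] by simp
  have pos: "m > 0" "k > 0"
    using m k prods_of_primes[OF Q] by auto
  then have ge1: "m * k \<ge> 1"
    by (simp add: Suc_le_eq)
  have only_mk: "i = m \<and> j = k" if "i * j = m * k" "f i \<noteq> 0" "g j \<noteq> 0" for i j
  proof -
    have "i * j \<in> prods_of Q"
      using mk by (simp only: that(1))
    then have "i \<in> prods_of Q" "j \<in> prods_of Q"
      by (simp_all add: mult_in_prods_of_iff[OF Q])
    then have le: "m \<le> i" "k \<le> j"
      using m_min[of i] k_min[of j] that by (auto simp: not_less[symmetric])
    have "i = m"
    proof (rule ccontr)
      assume "i \<noteq> m"
      with le pos have "m * k < i * j"
        by (intro mult_less_le_imp_less) auto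
      with that(1) show False by simp
    qed
    with that(1) pos show ?thesis by auto
  qed
  have "dirichlet_conv f g (m * k) = (\<Sum>(i, j)\<in>{(m, k)}. f i * g j)"
    unfolding dirichlet_conv_apply[OF ge1]
    by (rule sum.mono_neutral_right) (use finite_factor_pairs[OF ge1] in \<open>auto dest: only_mk\<close>)
  then have "dirichlet_conv f g (m * k) \<noteq> 0"
    using m k by simp
  with mk show ?thesis
    by blast
qed

theorem proposition3p12:
  fixes Q :: "nat set"
  assumes "\<forall>q\<in>Q. prime q"
  shows "primeideal (J_ideal Q) arith_ring"
proof (rule primeidealI)
  show "ideal (J_ideal Q) arith_ring"
    using assms by (rule ideal_J_ideal)
  show "cring arith_ring"
    by (rule cring_arith_ring)
  have "\<one>\<^bsub>arith_ring\<^esub> \<in> carrier arith_ring" "\<one>\<^bsub>arith_ring\<^esub> 1 \<noteq> 0"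
    by (auto simp: arith_ring_def)
  then show "carrier arith_ring \<noteq> J_ideal Q"
    using one_in_prods_of[of Q] by (auto simp: J_ideal_def)
next
  fix f g
  assume carrier: "f \<in> carrier arith_ring" "g \<in> carrier arith_ring"
    and prod: "f \<otimes>\<^bsub>arith_ring\<^esub> g \<in> J_ideal Q"
  from prod have "\<forall>n\<in>prods_of Q. dirichlet_conv f g n = 0"
    by (simp add: J_ideal_def arith_ring_def)
  with carrier show "f \<in> J_ideal Q \<or> g \<in> J_ideal Q"
    using dirichlet_conv_nonzero_on_prods_of[OF assms, of f g] by (auto simp: J_ideal_def)
qed

end
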